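(* Let $\mathbb D\subset\mathbb C$ be a simply connected domain and $F=(f,n):\mathbb D\to\mathrm U\mathbb H^3$ a smooth map with frame $\Phi:\mathbb D\to\mathrm{SL}_2\mathbb C$, i.e. $F=(\Phi\Phi^*,\Phi e_1\Phi^* )$. Put $\alpha=\Phi^{-1}\mathrm d\Phi$ and decompose $$(\alpha,\bar\alpha)=\alpha_0^{\mathbb C}+\alpha_1^{\mathbb C}+\alpha_2^{\mathbb C}+\alpha_3^{\mathbb C}$$ according to the eigenspace decomposition of $\mathfrak{sl}_2\mathbb C\times\mathfrak{sl}_2\mathbb C$ with respect to $\hat\tau$, where $\alpha_k^{\mathbb C}$ takes values in the eigenspace for the eigenvalue $i^k$. Then $\alpha_2^{\mathbb C}=(\alpha_2,\overline{\alpha_2})$ with $$\alpha_2=\tfrac12\,(F^*\omega)\,e_1 .$$ Thus $F$ is Legendre if and only if $\alpha_2=0$. In particular, if $F=(f,n)$ is the Gauss map of a conformal immersion $f:\mathbb D\to\mathbb H^3$ (with $n$ the unit normal of $f$), then $\alpha_2=\frac12(F^*\omega)e_1=\frac12\langle\mathrm df,n\rangle e_1=0$.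
   Context: $\mathrm{Her}_2\mathbb C$: Hermitian $2\times2$ matrices with Lorentzian scalar product determined by $\langle\xi,\xi\rangle=-\det\xi$; $\mathbb H^3=\{\xi:\det\xi=1,\mathrm{tr}\,\xi>0\}$; $\mathrm U\mathbb H^3=\{(x,v)\in\mathrm{Her}_2\mathbb C\times\mathrm{Her}_2\mathbb C:x\in\mathbb H^3,\langle v,v\rangle=1,\langle x,v\rangle=0\}$; $e_1=\mathrm{diag}(1,-1)$; $g^*=\bar g^t$. The canonical contact form on $\mathrm U\mathbb H^3$ is $\omega_{(x,v)}(X,V)=\langle X,v\rangle$, and a map $F$ into $\mathrm U\mathbb H^3$ is Legendre if $F^*\omega=0$. On $\mathfrak{sl}_2\mathbb C$ (as a real Lie algebra), $\tau\begin{pmatrix}a&b\\c&-a\end{pmatrix}=\begin{pmatrix}-\bar a&i\bar c\\-i\bar b&\bar a\end{pmatrix}$, an automorphism of order 4. The complexification of $\mathfrak{sl}_2\mathbb C$ is realized as $\mathfrak{sl}_2\mathbb C\times\mathfrak{sl}_2\mathbb C$ via $X\mapsto(X,\bar X)$, and the complex linear extension of $\tau$ is $\hat\tau(X,Y)=(\tau(\bar Y),\overline{\tau(X)})$. *)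

theory Defs
  imports "HOL-Analysis.Analysis"
begin

section \<open>Smooth maps\<close>

text \<open>All derivatives are Frechet derivatives over the reals; in particular the complex plane is
  treated as a real two-dimensional space. The definition below is meant for open \<open>S\<close> only.\<close>

primrec times_differentiable_on ::
    "nat \<Rightarrow> 'a::real_normed_vector set \<Rightarrow> ('a \<Rightarrow> 'b::real_normed_vector) \<Rightarrow> bool" where
  "times_differentiable_on 0 S f \<longleftrightarrow> continuous_on S f"
| "times_differentiable_on (Suc k) S f \<longleftrightarrow>
     (\<forall>x\<in>S. f differentiable (at x)) \<and>
     (\<forall>v. times_differentiable_on k S (\<lambda>x. frechet_derivative f (at x) v))"

definition smooth_on :: "'a::real_normed_vector set \<Rightarrow> ('a \<Rightarrow> 'b::real_normed_vector) \<Rightarrow> bool" where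
  "smooth_on S f \<longleftrightarrow> (\<forall>k. times_differentiable_on k S f)"

section \<open>Hermitian matrices, hyperbolic space and its unit tangent bundle\<close>

type_synonym cmat = "complex^2^2"

definition conj_mat :: "cmat \<Rightarrow> cmat" where
  "conj_mat A = map_matrix cnj A"

definition ctranspose :: "cmat \<Rightarrow> cmat" where
  "ctranspose A = transpose (conj_mat A)"

definition Her2 :: "cmat set" where
  "Her2 = {\<xi>. ctranspose \<xi> = \<xi>}"

text \<open>Polarization of the quadratic form \<open>\<xi> \<mapsto> - det \<xi>\<close>. The determinant is real on \<open>Her2\<close>, the
  only place where this form is used; \<open>Re\<close> just makes it real-valued.\<close>

definition lorentz :: "cmat \<Rightarrow> cmat \<Rightarrow> real" where
  "lorentz \<xi> \<eta> = - Re (det (\<xi> + \<eta>) - det \<xi> - det \<eta>) / 2"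

definition H3 :: "cmat set" where
  "H3 = {\<xi> \<in> Her2. det \<xi> = 1 \<and> Re (trace \<xi>) > 0}"

definition UH3 :: "(cmat \<times> cmat) set" where
  "UH3 = {(x, v). x \<in> H3 \<and> v \<in> Her2 \<and> lorentz v v = 1 \<and> lorentz x v = 0}"

definition e1 :: cmat where
  "e1 = vector [vector [1, 0], vector [0, -1]]"

definition SL2 :: "cmat set" where
  "SL2 = {A. det A = 1}"

definition sl2 :: "cmat set" where
  "sl2 = {A. trace A = 0}"

lemma Her2_det_real:
  assumes "\<xi> \<in> Her2" shows "complex_of_real (Re (det \<xi>)) = det \<xi>"
proof -
  have h: "cnj (\<xi>$j$i) = \<xi>$i$j" for i j
    using arg_cong[of _ _ "\<lambda>A. A$i$j", OF assms[unfolded Her2_def mem_Collect_eq]]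
    by (simp add: ctranspose_def conj_mat_def transpose_def)
  have "cnj (det \<xi>) = det \<xi>"
    by (simp add: det_2 h mult.commute)
  then show ?thesis
    by (metis Reals_cnj_iff of_real_Re)
qed

lemma lorentz_explicit:
  "lorentz \<xi> \<eta> = - Re (\<xi>$1$1 * \<eta>$2$2 + \<eta>$1$1 * \<xi>$2$2 - \<xi>$1$2 * \<eta>$2$1 - \<eta>$1$2 * \<xi>$2$1) / 2"
proof -
  have "det (\<xi> + \<eta>) - det \<xi> - det \<eta>
      = \<xi>$1$1 * \<eta>$2$2 + \<eta>$1$1 * \<xi>$2$2 - \<xi>$1$2 * \<eta>$2$1 - \<eta>$1$2 * \<xi>$2$1"
    unfolding det_2 vector_add_component by algebra
  then show ?thesis by (simp only: lorentz_def)
qed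

lemma lorentz_self: "lorentz \<xi> \<xi> = - Re (det \<xi>)"
  by (simp add: lorentz_explicit det_2)

lemma lorentz_commute: "lorentz \<xi> \<eta> = lorentz \<eta> \<xi>"
  by (simp only: lorentz_def add.commute diff_diff_eq)

lemma lorentz_add_left: "lorentz (\<xi> + \<xi>') \<eta> = lorentz \<xi> \<eta> + lorentz \<xi>' \<eta>"
  by (simp add: lorentz_explicit distrib_left distrib_right add_divide_distrib diff_divide_distrib)

lemma lorentz_scaleR_left: "lorentz (r *\<^sub>R \<xi>) \<eta> = r * lorentz \<xi> \<eta>"
  by (simp add: lorentz_explicit right_diff_distrib distrib_left)

section \<open>Contact form and Legendre maps\<close>

text \<open>A one-form on (a subset of) a vector space is a function of the base point and of a
  tangent vector.\<close>

definition contact_form :: "cmat \<times> cmat \<Rightarrow> cmat \<times> cmat \<Rightarrow> real" where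
  "contact_form = (\<lambda>(x, v) (X, V). lorentz X v)"

definition pullback ::
    "('a::real_normed_vector \<Rightarrow> 'b::real_normed_vector) \<Rightarrow> ('b \<Rightarrow> 'b \<Rightarrow> real) \<Rightarrow> 'a \<Rightarrow> 'a \<Rightarrow> real" where
  "pullback F \<omega> z X = \<omega> (F z) (frechet_derivative F (at z) X)"

definition legendre_on :: "complex set \<Rightarrow> (complex \<Rightarrow> cmat \<times> cmat) \<Rightarrow> bool" where
  "legendre_on D F \<longleftrightarrow> (\<forall>z\<in>D. \<forall>X. pullback F contact_form z X = 0)"

section \<open>Conformal immersions and unit normals\<close>

definition conformal_immersion_H3 :: "complex set \<Rightarrow> (complex \<Rightarrow> cmat) \<Rightarrow> bool" where
  "conformal_immersion_H3 D f \<longleftrightarrow>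
     smooth_on D f \<and> f ` D \<subseteq> H3 \<and>
     (\<forall>z\<in>D. inj (frechet_derivative f (at z)) \<and>
       (\<exists>\<rho>>0. \<forall>X Y. lorentz (frechet_derivative f (at z) X) (frechet_derivative f (at z) Y)
                    = \<rho> * (X \<bullet> Y)))"

text \<open>The first three conditions say that \<open>n z\<close> is a unit tangent vector of \<open>H3\<close> at \<open>f z\<close>. No
  orientation is fixed, so both choices of the unit normal are covered.\<close>

definition unit_normal_on :: "complex set \<Rightarrow> (complex \<Rightarrow> cmat) \<Rightarrow> (complex \<Rightarrow> cmat) \<Rightarrow> bool" where
  "unit_normal_on D f n \<longleftrightarrow>
     (\<forall>z\<in>D. n z \<in> Her2 \<and> lorentz (n z) (n z) = 1 \<and> lorentz (f z) (n z) = 0 \<and>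
       (\<forall>X. lorentz (frechet_derivative f (at z) X) (n z) = 0))"

section \<open>Frames and the Maurer--Cartan form\<close>

definition frame_on :: "complex set \<Rightarrow> (complex \<Rightarrow> cmat \<times> cmat) \<Rightarrow> (complex \<Rightarrow> cmat) \<Rightarrow> bool" where
  "frame_on D F \<Phi> \<longleftrightarrow>
     smooth_on D \<Phi> \<and> \<Phi> ` D \<subseteq> SL2 \<and>
     (\<forall>z\<in>D. F z = (\<Phi> z ** ctranspose (\<Phi> z), \<Phi> z ** e1 ** ctranspose (\<Phi> z)))"

definition mc_form :: "(complex \<Rightarrow> cmat) \<Rightarrow> complex \<Rightarrow> complex \<Rightarrow> cmat" where
  "mc_form \<Phi> z X = matrix_inv (\<Phi> z) ** frechet_derivative \<Phi> (at z) X"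

section \<open>The automorphism and its eigenspace decomposition\<close>

definition tau :: "cmat \<Rightarrow> cmat" where
  "tau A = vector [vector [- cnj (A$1$1), \<i> * cnj (A$2$1)],
                   vector [- \<i> * cnj (A$1$2), cnj (A$1$1)]]"

definition tau_hat :: "cmat \<times> cmat \<Rightarrow> cmat \<times> cmat" where
  "tau_hat = (\<lambda>(X, Y). (tau (conj_mat Y), conj_mat (tau X)))"

definition cscale :: "complex \<Rightarrow> cmat \<times> cmat \<Rightarrow> cmat \<times> cmat" where
  "cscale c = (\<lambda>(X, Y). (map_matrix ((*) c) X, map_matrix ((*) c) Y))"

definition tau_eigenspace :: "nat \<Rightarrow> (cmat \<times> cmat) set" where
  "tau_eigenspace k = {P \<in> sl2 \<times> sl2. tau_hat P = cscale (\<i> ^ k) P}"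

definition tau_decomposition :: "cmat \<times> cmat \<Rightarrow> (nat \<Rightarrow> cmat \<times> cmat) \<Rightarrow> bool" where
  "tau_decomposition P q \<longleftrightarrow> (\<forall>k<4. q k \<in> tau_eigenspace k) \<and> P = (\<Sum>k<4. q k)"

definition tau_part :: "nat \<Rightarrow> cmat \<times> cmat \<Rightarrow> cmat \<times> cmat" where
  "tau_part k P = (THE Q. \<exists>q. tau_decomposition P q \<and> q k = Q)"

definition mc_part :: "nat \<Rightarrow> (complex \<Rightarrow> cmat) \<Rightarrow> complex \<Rightarrow> complex \<Rightarrow> cmat \<times> cmat" where
  "mc_part k \<Phi> z X = tau_part k (mc_form \<Phi> z X, conj_mat (mc_form \<Phi> z X))"

lemma tau_hat_extends_tau: "tau_hat (X, conj_mat X) = (tau X, conj_mat (tau X))"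
proof -
  have "conj_mat (conj_mat X) = X"
    by (simp add: conj_mat_def vec_eq_iff)
  then show ?thesis by (simp add: tau_hat_def)
qed

lemma tau_hat_cscale: "tau_hat (cscale c P) = cscale c (tau_hat P)"
  by (cases P)
    (simp add: tau_hat_def cscale_def tau_def conj_mat_def vec_eq_iff forall_2)

lemma tau_hat_add: "tau_hat (P + Q) = tau_hat P + tau_hat Q"
  by (cases P; cases Q)
    (simp add: tau_hat_def tau_def conj_mat_def vec_eq_iff forall_2 algebra_simps)

lemma mem_tau_eigenspace:
  "(X, Y) \<in> tau_eigenspace k \<longleftrightarrow>
     X$2$2 = - X$1$1 \<and> Y$2$2 = - Y$1$1 \<and>
     - Y$1$1 = \<i>^k * X$1$1 \<and> \<i> * Y$2$1 = \<i>^k * X$1$2 \<and> - \<i> * Y$1$2 = \<i>^k * X$2$1 \<and>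
     - X$1$1 = \<i>^k * Y$1$1 \<and> - \<i> * X$2$1 = \<i>^k * Y$1$2 \<and> \<i> * X$1$2 = \<i>^k * Y$2$1"
proof -
  have tr: "trace A = 0 \<longleftrightarrow> A$2$2 = - A$1$1" for A :: cmat
    by (auto simp: trace_def sum_2 add_eq_0_iff)
  show ?thesis
  proof (cases "X$2$2 = - X$1$1 \<and> Y$2$2 = - Y$1$1")
    case True
    then show ?thesis
      by (simp add: tau_eigenspace_def sl2_def tau_hat_def cscale_def tau_def conj_mat_def tr
          vec_eq_iff forall_2)
        (metis minus_minus)
  next
    case False
    then show ?thesis by (auto simp: tau_eigenspace_def sl2_def tr)
  qed
qed

lemma tau_eigenspace_0:
  "(X, Y) \<in> tau_eigenspace 0 \<longleftrightarrow>
     X$2$2 = - X$1$1 \<and> Y$1$1 = - X$1$1 \<and> Y$2$2 = X$1$1 \<and>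
     X$1$2 = 0 \<and> X$2$1 = 0 \<and> Y$1$2 = 0 \<and> Y$2$1 = 0"
  unfolding mem_tau_eigenspace
  by (simp add: complex_eq_iff; intro iffI conjI; elim conjE; linarith)

lemma tau_eigenspace_1:
  "(X, Y) \<in> tau_eigenspace 1 \<longleftrightarrow>
     X$1$1 = 0 \<and> X$2$2 = 0 \<and> Y$1$1 = 0 \<and> Y$2$2 = 0 \<and> Y$2$1 = X$1$2 \<and> Y$1$2 = - X$2$1"
  unfolding mem_tau_eigenspace
  by (simp add: complex_eq_iff; intro iffI conjI; elim conjE; linarith)

lemma tau_eigenspace_2:
  "(X, Y) \<in> tau_eigenspace 2 \<longleftrightarrow>
     X$2$2 = - X$1$1 \<and> Y$1$1 = X$1$1 \<and> Y$2$2 = - X$1$1 \<and>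
     X$1$2 = 0 \<and> X$2$1 = 0 \<and> Y$1$2 = 0 \<and> Y$2$1 = 0"
  unfolding mem_tau_eigenspace
  by (simp add: complex_eq_iff; intro iffI conjI; elim conjE; linarith)

lemma tau_eigenspace_3:
  "(X, Y) \<in> tau_eigenspace 3 \<longleftrightarrow>
     X$1$1 = 0 \<and> X$2$2 = 0 \<and> Y$1$1 = 0 \<and> Y$2$2 = 0 \<and> Y$2$1 = - X$1$2 \<and> Y$1$2 = X$2$1"
  unfolding mem_tau_eigenspace
  by (simp add: complex_eq_iff power3_eq_cube; intro iffI conjI; elim conjE; linarith)

lemma lessThan_4: "{..<4::nat} = {0, 1, 2, 3}"
  by auto

lemma tau_decomposition_iff:
  "tau_decomposition P q \<longleftrightarrow>
     q 0 \<in> tau_eigenspace 0 \<and> q 1 \<in> tau_eigenspace 1 \<and>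
     q 2 \<in> tau_eigenspace 2 \<and> q 3 \<in> tau_eigenspace 3 \<and> P = q 0 + q 1 + q 2 + q 3"
proof -
  have "(\<forall>k<4. Q k) \<longleftrightarrow> Q 0 \<and> Q 1 \<and> Q 2 \<and> Q 3" for Q :: "nat \<Rightarrow> bool"
    using lessThan_4 by (metis (full_types) insert_iff lessThan_iff empty_iff)
  then show ?thesis
    unfolding tau_decomposition_def by (simp add: lessThan_4 add.assoc)
qed

text \<open>The eigenspaces give a direct sum decomposition, so \<open>tau_part\<close> is well defined.\<close>

lemma tau_decomposition_exists:
  assumes "P \<in> sl2 \<times> sl2" shows "\<exists>q. tau_decomposition P q"
proof -
  obtain X Y where P: "P = (X, Y)" by (cases P)
  have tr: "X$2$2 = - X$1$1" "Y$2$2 = - Y$1$1"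
    using assms by (auto simp: P sl2_def trace_def sum_2 add_eq_0_iff)
  define M :: "complex \<Rightarrow> complex \<Rightarrow> complex \<Rightarrow> complex \<Rightarrow> cmat"
    where "M a b c d = vector [vector [a, b], vector [c, d]]" for a b c d
  have M: "M a b c d $ 1 $ 1 = a" "M a b c d $ 1 $ 2 = b" "M a b c d $ 2 $ 1 = c"
    "M a b c d $ 2 $ 2 = d" for a b c d by (simp_all add: M_def)
  define a0 where "a0 = (X$1$1 - Y$1$1) / 2"
  define a2 where "a2 = (X$1$1 + Y$1$1) / 2"
  define b1 where "b1 = (X$1$2 + Y$2$1) / 2"
  define b3 where "b3 = (X$1$2 - Y$2$1) / 2"
  define c1 where "c1 = (X$2$1 - Y$1$2) / 2"
  define c3 where "c3 = (X$2$1 + Y$1$2) / 2"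
  define q where "q k =
     (if k = 0 then (M a0 0 0 (-a0), M (-a0) 0 0 a0)
      else if k = 1 then (M 0 b1 c1 0, M 0 (-c1) b1 0)
      else if k = 2 then (M a2 0 0 (-a2), M a2 0 0 (-a2))
      else (M 0 b3 c3 0, M 0 c3 (-b3) 0))" for k :: nat
  have "P = q 0 + q 1 + q 2 + q 3"
    by (simp add: P q_def vec_eq_iff forall_2 M tr a0_def a2_def b1_def b3_def c1_def c3_def
        field_simps)
  then have "tau_decomposition P q"
    unfolding tau_decomposition_iff
    by (simp add: q_def M tau_eigenspace_0 tau_eigenspace_1[unfolded One_nat_def] tau_eigenspace_2
        tau_eigenspace_3)
  then show ?thesis by blast
qed

lemma tau_decomposition_unique:
  assumes "tau_decomposition P q" "tau_decomposition P r" "k < 4"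
  shows "q k = r k"
proof -
  have half: "a = a'" if "a + b = a' + b'" "a - b = a' - b'" for a b a' b' :: complex
  proof -
    have "2 * a = (a + b) + (a - b)" by simp
    also have "\<dots> = 2 * a'" by (simp add: that)
    finally show ?thesis by simp
  qed
  define A where "A j = fst (q j)" for j
  define B where "B j = snd (q j)" for j
  define A' where "A' j = fst (r j)" for j
  define B' where "B' j = snd (r j)" for j
  have q: "q j = (A j, B j)" and r: "r j = (A' j, B' j)" for j
    by (simp_all add: A_def B_def A'_def B'_def)
  note d = assms(1,2)[unfolded tau_decomposition_iff q r tau_eigenspace_0 tau_eigenspace_1
      tau_eigenspace_2 tau_eigenspace_3]
  have eq: "A 0 + A 1 + A 2 + A 3 = A' 0 + A' 1 + A' 2 + A' 3"
    "B 0 + B 1 + B 2 + B 3 = B' 0 + B' 1 + B' 2 + B' 3"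
    using assms(1,2)[unfolded tau_decomposition_iff q r] by simp_all
  have eA: "(A 0 + A 1 + A 2 + A 3)$i$j = (A' 0 + A' 1 + A' 2 + A' 3)$i$j" for i j
    by (simp only: eq)
  have eB: "(B 0 + B 1 + B 2 + B 3)$i$j = (B' 0 + B' 1 + B' 2 + B' 3)$i$j" for i j
    by (simp only: eq)
  have a: "A 0$1$1 + A 2$1$1 = A' 0$1$1 + A' 2$1$1" "A 2$1$1 - A 0$1$1 = A' 2$1$1 - A' 0$1$1"
    using eA[of 1 1] eB[of 1 1] d by simp_all
  have b: "A 1$1$2 + A 3$1$2 = A' 1$1$2 + A' 3$1$2" "A 1$1$2 - A 3$1$2 = A' 1$1$2 - A' 3$1$2"
    using eA[of 1 2] eB[of 2 1] d by simp_all
  have c: "A 1$2$1 + A 3$2$1 = A' 1$2$1 + A' 3$2$1" "A 3$2$1 - A 1$2$1 = A' 3$2$1 - A' 1$2$1"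
    using eA[of 2 1] eB[of 1 2] d by simp_all
  have a2: "A 2$1$1 = A' 2$1$1" by (rule half[of _ "A 0$1$1" _ "A' 0$1$1"]) (use a in \<open>simp_all add: add.commute\<close>)
  have b1: "A 1$1$2 = A' 1$1$2" using b by (rule half)
  have c3: "A 3$2$1 = A' 3$2$1" by (rule half[of _ "A 1$2$1" _ "A' 1$2$1"]) (use c in \<open>simp_all add: add.commute\<close>)
  have a0: "A 0$1$1 = A' 0$1$1" using a a2 by simp
  have b3: "A 3$1$2 = A' 3$1$2" using b b1 by simp
  have c1: "A 1$2$1 = A' 1$2$1" using c c3 by simp
  have "q 0 = r 0" "q 1 = r 1" "q 2 = r 2" "q 3 = r 3"
    by (simp_all add: q r vec_eq_iff forall_2 d a0 a2 b1 b3 c1 c3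
        d[unfolded One_nat_def] b1[unfolded One_nat_def] c1[unfolded One_nat_def])
  moreover have "k \<in> {0, 1, 2, 3}" using assms(3) lessThan_4 by blast
  ultimately show ?thesis by blast
qed

lemma tau_part_eqI:
  assumes "tau_decomposition P q" "k < 4" shows "tau_part k P = q k"
  unfolding tau_part_def
proof (rule the_equality)
  show "\<exists>q'. tau_decomposition P q' \<and> q' k = q k"
    using assms(1) by (intro exI[of _ q]) simp
  show "Q = q k" if "\<exists>q'. tau_decomposition P q' \<and> q' k = Q" for Q
  proof -
    from that obtain q' where q': "tau_decomposition P q'" "q' k = Q" by (elim exE conjE)
    then show ?thesis using tau_decomposition_unique[OF q'(1) assms] by simp
  qed
qed

end

theory Submission
  imports Defs
begin

text \<open>
  Writing \<open>\<alpha> = \<Phi>\<^sup>-\<^sup>1 d\<Phi>\<close>, the product rule applied to \<open>f = \<Phi> \<Phi>\<^sup>*\<close> gives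
  \<open>df = \<Phi> (\<alpha> + \<alpha>\<^sup>*) \<Phi>\<^sup>*\<close>, while \<open>n = \<Phi> e\<^sub>1 \<Phi>\<^sup>*\<close>. The group \<open>SL\<^sub>2\<close> acts on matrices by
  \<open>\<xi> \<mapsto> \<Phi> \<xi> \<Phi>\<^sup>*\<close>, and this action preserves the determinant, hence the Lorentzian product. So
  the contact form pulls back to \<open>\<langle>df, n\<rangle> = \<langle>\<alpha> + \<alpha>\<^sup>*, e\<^sub>1\<rangle> = 2 Re \<alpha>\<^sub>1\<^sub>1\<close>, where the last equality uses
  \<open>tr \<alpha> = 0\<close>, the infinitesimal form of \<open>det \<Phi> = 1\<close>.

  On the other side, the eigenspace of \<open>tau_hat\<close> for the eigenvalue \<open>-1\<close> is the complex line
  spanned by \<open>(e\<^sub>1, e\<^sub>1)\<close>. Projecting to it averages the upper left entries of the two factors, so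
  a real point \<open>(\<alpha>, conj \<alpha>)\<close> has the component \<open>Re \<alpha>\<^sub>1\<^sub>1 (e\<^sub>1, e\<^sub>1)\<close>. Comparing the two computations
  gives \<open>\<alpha>\<^sub>2 = 1/2 (F\<^sup>*\<omega>) e\<^sub>1\<close>; everything else follows because \<open>e\<^sub>1\<close> does not vanish, and because
  the unit normal of \<open>f\<close> is by definition orthogonal to \<open>df\<close>.
\<close>

section \<open>The conjugation action preserves the Lorentzian product\<close>

lemma ctranspose_nth: "ctranspose A $ i $ j = cnj (A $ j $ i)"
  by (simp add: ctranspose_def conj_mat_def transpose_def)

lemma ctranspose_mult: "ctranspose (A ** B) = ctranspose B ** ctranspose A"
  by (simp add: vec_eq_iff ctranspose_nth matrix_matrix_mult_def mult.commute)

lemma det_ctranspose: "det (ctranspose A) = cnj (det A)"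
  by (simp add: det_2 ctranspose_nth mult.commute)

lemma matrix_add_rdistrib: "(B + C) ** A = B ** A + C ** A"
  by (simp add: vec_eq_iff matrix_matrix_mult_def distrib_right sum.distrib)

lemma lorentz_SL2_invariant:
  assumes "A \<in> SL2"
  shows "lorentz (A ** X ** ctranspose A) (A ** Y ** ctranspose A) = lorentz X Y"
proof -
  have "det (A ** Z ** ctranspose A) = det Z" for Z
    using assms by (simp add: SL2_def det_mul det_ctranspose)
  then show ?thesis
    by (simp add: lorentz_def flip: matrix_add_ldistrib matrix_add_rdistrib)
qed

lemma e1_nth [simp]: "e1$1$1 = 1" "e1$1$2 = 0" "e1$2$1 = 0" "e1$2$2 = -1"
  by (simp_all add: e1_def)

lemma e1_nonzero: "e1 \<noteq> 0"
  using e1_nth(1) by (metis zero_index zero_neq_one)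

lemma lorentz_hermitian_part_e1:
  assumes "a \<in> sl2"
  shows "lorentz (a + ctranspose a) e1 = 2 * Re (a$1$1)"
proof -
  have "a$2$2 = - a$1$1"
    using assms by (simp add: sl2_def trace_def sum_2 add_eq_0_iff)
  then show ?thesis
    by (simp add: lorentz_explicit ctranspose_nth)
qed

section \<open>The eigencomponent for the eigenvalue -1\<close>

lemma real_point_in_sl2: "a \<in> sl2 \<Longrightarrow> (a, conj_mat a) \<in> sl2 \<times> sl2"
  by (auto simp: sl2_def conj_mat_def trace_def sum_2 simp flip: complex_cnj_add)

text \<open>The entries (1,1) of the other three components either vanish or differ in sign between the
  two factors, so adding the entries (1,1) of the two factors isolates the component sought.\<close>

lemma tau_part_2_real_point:
  assumes "a \<in> sl2"
  shows "tau_part 2 (a, conj_mat a) = (Re (a$1$1) *\<^sub>R e1, Re (a$1$1) *\<^sub>R e1)"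
proof -
  obtain q where q: "tau_decomposition (a, conj_mat a) q"
    using tau_decomposition_exists[OF real_point_in_sl2[OF assms]] by blast
  define A B where "A k = fst (q k)" and "B k = snd (q k)" for k
  have qAB: "q k = (A k, B k)" for k
    by (simp add: A_def B_def)
  note d = q[unfolded tau_decomposition_iff qAB tau_eigenspace_0 tau_eigenspace_1
      tau_eigenspace_2 tau_eigenspace_3]
  have "a = A 0 + A 1 + A 2 + A 3" "conj_mat a = B 0 + B 1 + B 2 + B 3"
    using q[unfolded tau_decomposition_iff qAB add_Pair prod.inject] by blast+
  then have "a$1$1 = (A 0 + A 1 + A 2 + A 3)$1$1" "conj_mat a$1$1 = (B 0 + B 1 + B 2 + B 3)$1$1"
    by metis+
  then have "a$1$1 + cnj (a$1$1) = 2 * A 2$1$1"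
    using d by (simp add: conj_mat_def)
  then have "A 2$1$1 = of_real (Re (a$1$1))"
    by (simp add: complex_add_cnj)
  then have "A 2 = Re (a$1$1) *\<^sub>R e1 \<and> B 2 = Re (a$1$1) *\<^sub>R e1"
    using d by (simp add: vec_eq_iff forall_2 of_real_def)
  then show ?thesis
    using tau_part_eqI[OF q, of 2] by (simp add: qAB)
qed

lemma tau_decomposition_tau_part:
  assumes "P \<in> sl2 \<times> sl2"
  shows "tau_decomposition P (\<lambda>k. tau_part k P)"
proof -
  obtain q where q: "tau_decomposition P q"
    using tau_decomposition_exists[OF assms] by blast
  then show ?thesis
    using tau_part_eqI[OF q] by (simp add: tau_decomposition_def)
qed

lemma conj_mat_real_multiple_e1: "conj_mat (r *\<^sub>R e1) = r *\<^sub>R e1"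
  by (simp add: conj_mat_def vec_eq_iff forall_2)

section \<open>The Maurer--Cartan form of a frame\<close>

lemma smooth_on_has_derivative:
  assumes "smooth_on S g" "z \<in> S"
  shows "(g has_derivative frechet_derivative g (at z)) (at z)"
proof -
  have "times_differentiable_on (Suc 0) S g"
    using assms(1) unfolding smooth_on_def by blast
  then show ?thesis
    using assms(2) by (simp add: frechet_derivative_works)
qed

lemma SL2_mult_mc_form:
  assumes "\<Phi> z \<in> SL2"
  shows "\<Phi> z ** mc_form \<Phi> z X = frechet_derivative \<Phi> (at z) X"
proof -
  have "invertible (\<Phi> z)"
    using assms by (simp add: SL2_def invertible_det_nz)
  then have "\<Phi> z ** matrix_inv (\<Phi> z) = mat 1"
    unfolding invertible_def matrix_inv_def by (rule someI_ex[THEN conjunct1])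
  then show ?thesis
    by (simp add: mc_form_def matrix_mul_assoc)
qed

text \<open>This is Jacobi's formula: the derivative of \<open>det \<Phi>\<close> is \<open>det \<Phi> * trace (\<Phi>\<^sup>-\<^sup>1 d\<Phi>)\<close>, and
  \<open>det \<Phi>\<close> is constant on the open set \<open>D\<close>.\<close>

lemma mc_form_in_sl2:
  assumes "open D" "z \<in> D" "smooth_on D \<Phi>" "\<Phi> ` D \<subseteq> SL2"
  shows "mc_form \<Phi> z X \<in> sl2"
proof -
  define d where "d = frechet_derivative \<Phi> (at z)"
  define a where "a = mc_form \<Phi> z X"
  have "(\<Phi> has_derivative d) (at z)"
    unfolding d_def by (rule smooth_on_has_derivative[OF assms(3,2)])
  then have entry: "((\<lambda>w. \<Phi> w $ i $ j) has_derivative (\<lambda>X. d X $ i $ j)) (at z)" for i j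
    by (intro bounded_linear.has_derivative[OF bounded_linear_vec_nth])
  have "((\<lambda>w. det (\<Phi> w)) has_derivative
      (\<lambda>X. \<Phi> z$1$1 * d X$2$2 + d X$1$1 * \<Phi> z$2$2
         - (\<Phi> z$1$2 * d X$2$1 + d X$1$2 * \<Phi> z$2$1))) (at z)"
    unfolding det_2 by (intro has_derivative_diff has_derivative_mult entry)
  moreover have "((\<lambda>w. det (\<Phi> w)) has_derivative (\<lambda>X. 0)) (at z)"
    by (rule has_derivative_transform_within_open[OF has_derivative_const[of 1] assms(1,2)])
      (use assms(4) in \<open>auto simp: SL2_def\<close>)
  ultimately have "\<Phi> z$1$1 * d X$2$2 + d X$1$1 * \<Phi> z$2$2
      - (\<Phi> z$1$2 * d X$2$1 + d X$1$2 * \<Phi> z$2$1) = 0"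
    by (rule has_derivative_unique[THEN fun_cong])
  moreover have "d X = \<Phi> z ** a"
    unfolding d_def a_def using SL2_mult_mc_form assms(2,4) by (metis image_subset_iff)
  ultimately have "det (\<Phi> z) * trace a = 0"
    by (simp add: det_2 trace_def sum_2 matrix_matrix_mult_def algebra_simps)
  moreover have "det (\<Phi> z) = 1"
    using assms(2,4) by (auto simp: SL2_def)
  ultimately show ?thesis
    by (simp add: sl2_def a_def)
qed

text \<open>The product is only real bilinear, because \<open>ctranspose\<close> is conjugate linear; real
  bilinearity is what the product rule for real derivatives asks for.\<close>

lemma bounded_bilinear_mult_ctranspose:
  "bounded_bilinear (\<lambda>A B :: cmat. A ** ctranspose B)"
proof -
  have "bilinear (\<lambda>A B :: cmat. A ** ctranspose B)"
    by (auto simp: bilinear_def vec_eq_iff matrix_matrix_mult_def ctranspose_nth sum_2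
        algebra_simps intro!: linearI)
  then show ?thesis
    by (simp add: bilinear_conv_bounded_bilinear)
qed

lemma has_derivative_mult_ctranspose:
  assumes "\<Phi> z \<in> SL2" "(\<Phi> has_derivative frechet_derivative \<Phi> (at z)) (at z)"
  shows "((\<lambda>w. \<Phi> w ** ctranspose (\<Phi> w)) has_derivative
    (\<lambda>X. \<Phi> z ** (mc_form \<Phi> z X + ctranspose (mc_form \<Phi> z X)) ** ctranspose (\<Phi> z))) (at z)"
proof -
  let ?d = "frechet_derivative \<Phi> (at z)"
  have "\<Phi> z ** ctranspose (?d X) + ?d X ** ctranspose (\<Phi> z)
      = \<Phi> z ** (mc_form \<Phi> z X + ctranspose (mc_form \<Phi> z X)) ** ctranspose (\<Phi> z)" for X
    unfolding SL2_mult_mc_form[where \<Phi> = \<Phi> and z = z, OF assms(1), symmetric]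
    by (simp add: ctranspose_mult matrix_add_ldistrib matrix_add_rdistrib matrix_mul_assoc
        add.commute)
  then show ?thesis
    using bounded_bilinear.FDERIV[OF bounded_bilinear_mult_ctranspose assms(2,2)] by simp
qed

text \<open>The frame carries \<open>\<alpha> + \<alpha>\<^sup>*\<close> to \<open>df\<close> and \<open>e\<^sub>1\<close> to \<open>n\<close> by one and the same Lorentz isometry,
  so the contact form can be evaluated at the identity matrix.\<close>

lemma pullback_contact_form_frame:
  assumes "open D" "z \<in> D" "smooth_on D F" "frame_on D F \<Phi>"
  shows "pullback F contact_form z X = 2 * Re (mc_form \<Phi> z X $ 1 $ 1)"
proof -
  have \<Phi>: "smooth_on D \<Phi>" "\<Phi> ` D \<subseteq> SL2"
    and F: "\<And>w. w \<in> D \<Longrightarrow> F w = (\<Phi> w ** ctranspose (\<Phi> w), \<Phi> w ** e1 ** ctranspose (\<Phi> w))"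
    using assms(4) by (auto simp: frame_on_def)
  have \<Phi>z: "\<Phi> z \<in> SL2"
    using \<Phi>(2) assms(2) by blast
  let ?df = "\<lambda>X. \<Phi> z ** (mc_form \<Phi> z X + ctranspose (mc_form \<Phi> z X)) ** ctranspose (\<Phi> z)"
  have "((\<lambda>w. fst (F w)) has_derivative (\<lambda>X. fst (frechet_derivative F (at z) X))) (at z)"
    by (intro has_derivative_fst smooth_on_has_derivative[OF assms(3,2)])
  moreover have "((\<lambda>w. fst (F w)) has_derivative ?df) (at z)"
    by (rule has_derivative_transform_within_open[OF has_derivative_mult_ctranspose[OF \<Phi>z
            smooth_on_has_derivative[OF \<Phi>(1) assms(2)]] assms(1,2)])
      (simp add: F)
  ultimately have "fst (frechet_derivative F (at z) X) = ?df X"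
    by (rule has_derivative_unique[THEN fun_cong])
  then have "pullback F contact_form z X = lorentz (?df X) (\<Phi> z ** e1 ** ctranspose (\<Phi> z))"
    by (simp add: pullback_def contact_form_def F[OF assms(2)] split_beta)
  also have "\<dots> = lorentz (mc_form \<Phi> z X + ctranspose (mc_form \<Phi> z X)) e1"
    by (rule lorentz_SL2_invariant[OF \<Phi>z])
  also have "\<dots> = 2 * Re (mc_form \<Phi> z X $ 1 $ 1)"
    by (rule lorentz_hermitian_part_e1[OF mc_form_in_sl2[OF assms(1,2) \<Phi>]])
  finally show ?thesis .
qed

section \<open>The contact form as a component of the Maurer--Cartan form\<close>

lemma mc_part_2_eq_contact_form:
  assumes "open D" "z \<in> D" "smooth_on D F" "frame_on D F \<Phi>"
  shows "mc_part 2 \<Phi> z X =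
    ((1/2 * pullback F contact_form z X) *\<^sub>R e1, (1/2 * pullback F contact_form z X) *\<^sub>R e1)"
proof -
  have "mc_form \<Phi> z X \<in> sl2"
    using mc_form_in_sl2 assms(1,2,4) by (simp add: frame_on_def)
  then show ?thesis
    by (simp add: mc_part_def tau_part_2_real_point pullback_contact_form_frame[OF assms])
qed

lemma pullback_contact_form_pair:
  assumes "((\<lambda>w. (f w, n w)) has_derivative
    frechet_derivative (\<lambda>w. (f w, n w)) (at z)) (at z)"
  shows "pullback (\<lambda>w. (f w, n w)) contact_form z X
    = lorentz (frechet_derivative f (at z) X) (n z)"
proof -
  have "(f has_derivative (\<lambda>X. fst (frechet_derivative (\<lambda>w. (f w, n w)) (at z) X))) (at z)"
    using has_derivative_fst[OF assms] by simp
  then have "frechet_derivative f (at z)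
      = (\<lambda>X. fst (frechet_derivative (\<lambda>w. (f w, n w)) (at z) X))"
    by (rule frechet_derivative_at[symmetric])
  then show ?thesis
    by (simp add: pullback_def contact_form_def split_beta)
qed

theorem proposition7p1:
  fixes D :: "complex set"
    and F :: "complex \<Rightarrow> cmat \<times> cmat"
    and f n \<Phi> :: "complex \<Rightarrow> cmat"
    and \<alpha>\<^sub>2 :: "complex \<Rightarrow> complex \<Rightarrow> cmat"
  assumes "open D" and "connected D" and "D \<noteq> {}" and "simply_connected D"
    and "F = (\<lambda>z. (f z, n z))"
    and "F ` D \<subseteq> UH3"
    and "smooth_on D F"
    and "frame_on D F \<Phi>"
    and "\<alpha>\<^sub>2 = (\<lambda>z X. fst (mc_part 2 \<Phi> z X))"
  shows "(\<forall>z\<in>D. \<forall>X. tau_decomposition (mc_form \<Phi> z X, conj_mat (mc_form \<Phi> z X))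
                                   (\<lambda>k. mc_part k \<Phi> z X))
       \<and> (\<forall>z\<in>D. \<forall>X. mc_part 2 \<Phi> z X = (\<alpha>\<^sub>2 z X, conj_mat (\<alpha>\<^sub>2 z X)))
       \<and> (\<forall>z\<in>D. \<forall>X. \<alpha>\<^sub>2 z X = (1/2 * pullback F contact_form z X) *\<^sub>R e1)
       \<and> (legendre_on D F \<longleftrightarrow> (\<forall>z\<in>D. \<forall>X. \<alpha>\<^sub>2 z X = 0))
       \<and> (conformal_immersion_H3 D f \<and> unit_normal_on D f n \<longrightarrow>
            (\<forall>z\<in>D. \<forall>X. \<alpha>\<^sub>2 z X = (1/2 * pullback F contact_form z X) *\<^sub>R e1
                     \<and> \<alpha>\<^sub>2 z X = (1/2 * lorentz (frechet_derivative f (at z) X) (n z)) *\<^sub>R e1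
                     \<and> \<alpha>\<^sub>2 z X = 0))"
proof -
  let ?\<omega> = "pullback F contact_form"
  have part: "mc_part 2 \<Phi> z X = ((1/2 * ?\<omega> z X) *\<^sub>R e1, (1/2 * ?\<omega> z X) *\<^sub>R e1)"
    if "z \<in> D" for z X
    using mc_part_2_eq_contact_form[OF assms(1) that assms(7,8)] .
  have \<alpha>\<^sub>2: "\<alpha>\<^sub>2 z X = (1/2 * ?\<omega> z X) *\<^sub>R e1" if "z \<in> D" for z X
    using part[OF that] by (simp add: assms(9))
  have "tau_decomposition (mc_form \<Phi> z X, conj_mat (mc_form \<Phi> z X)) (\<lambda>k. mc_part k \<Phi> z X)"
    if "z \<in> D" for z X
  proof -
    have "mc_form \<Phi> z X \<in> sl2"
      using mc_form_in_sl2 assms(1,8) that by (simp add: frame_on_def)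
    then show ?thesis
      unfolding mc_part_def
      by (intro tau_decomposition_tau_part real_point_in_sl2)
  qed
  moreover have "mc_part 2 \<Phi> z X = (\<alpha>\<^sub>2 z X, conj_mat (\<alpha>\<^sub>2 z X))" if "z \<in> D" for z X
    unfolding part[OF that] \<alpha>\<^sub>2[OF that] conj_mat_real_multiple_e1 ..
  moreover have "legendre_on D F \<longleftrightarrow> (\<forall>z\<in>D. \<forall>X. \<alpha>\<^sub>2 z X = 0)"
    unfolding legendre_on_def using e1_nonzero by (simp add: \<alpha>\<^sub>2)
  moreover have "\<alpha>\<^sub>2 z X = (1/2 * lorentz (frechet_derivative f (at z) X) (n z)) *\<^sub>R e1 \<and> \<alpha>\<^sub>2 z X = 0"
    if "unit_normal_on D f n" "z \<in> D" for z X
  proof -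
    have "?\<omega> z X = lorentz (frechet_derivative f (at z) X) (n z)"
      unfolding assms(5)
      by (rule pullback_contact_form_pair)
        (rule smooth_on_has_derivative[OF assms(7)[unfolded assms(5)] that(2)])
    moreover have "lorentz (frechet_derivative f (at z) X) (n z) = 0"
      using that by (simp add: unit_normal_on_def)
    ultimately show ?thesis
      by (simp add: \<alpha>\<^sub>2[OF that(2)])
  qed
  ultimately show ?thesis
    using \<alpha>\<^sub>2 by blast
qed

end
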